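(* The estimate $$\left\|\frac{M(f)}{Mw}\right\|_{L^{1,\infty}(Mw)}\le c\, \|f\|_{L^1(\mathbb{R}^n)},$$ that is, the inequality $\left\|\frac{M(f)}{v}\right\|_{L^{1,\infty}(v)}\le c\,\|f\|_{L^1(\mathbb{R}^n)}$ with $v=Mw$, is false for a general function $w$ or measure $w$.
   Context: $M$ is the Hardy–Littlewood maximal operator on $\mathbb{R}^n$, $Mh(x)=\sup_{Q\ni x}\frac1{|Q|}\int_Q|h|$, the supremum being over all cubes $Q$ containing $x$; for a measure $w$, $Mw(x)=\sup_{Q\ni x}\frac{w(Q)}{|Q|}$. For a nonnegative function $v$, $\|F\|_{L^{1,\infty}(v)}=\sup_{t>0} t\int_{\{x:|F(x)|>t\}}v\,dx$. Here $c$ denotes a constant. *)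

theory Defs
  imports "HOL-Analysis.Analysis"
begin

definition cubes :: "(real ^ 'n) set set" where
  "cubes = {cbox a (\<chi> i. a $ i + l) | a l. 0 < l}"

definition maximal_fun :: "(real ^ 'n \<Rightarrow> real) \<Rightarrow> real ^ 'n \<Rightarrow> ennreal" where
  "maximal_fun h x =
     (SUP Q\<in>{Q\<in>cubes. x \<in> Q}. (\<integral>\<^sup>+y\<in>Q. ennreal \<bar>h y\<bar> \<partial>lborel) / emeasure lborel Q)"

definition maximal_measure :: "(real ^ 'n) measure \<Rightarrow> real ^ 'n \<Rightarrow> ennreal" where
  "maximal_measure \<mu> x = (SUP Q\<in>{Q\<in>cubes. x \<in> Q}. emeasure \<mu> Q / emeasure lborel Q)"

(* The quasinorm is taken in the extended nonnegative reals, for nonnegative F. *)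
definition weak_L1_norm :: "(real ^ 'n \<Rightarrow> ennreal) \<Rightarrow> (real ^ 'n \<Rightarrow> ennreal) \<Rightarrow> ennreal" where
  "weak_L1_norm v F =
     (SUP t\<in>{0::real<..}. ennreal t * (\<integral>\<^sup>+x\<in>{x. F x > ennreal t}. v x \<partial>lborel))"

definition L1_norm :: "(real ^ 'n \<Rightarrow> real) \<Rightarrow> ennreal" where
  "L1_norm f = (\<integral>\<^sup>+x. ennreal \<bar>f x\<bar> \<partial>lborel)"

(* The quotient is formed in ennreal, where a / \<infinity> = 0 for every a, 0 / 0 = 0 and
   a / 0 = \<infinity> for a > 0. In the estimate v = Mw, so points with v = 0 carry no mass and
   points with v = \<infinity> never lie in a superlevel set. *)
definition mixed_weak_estimate :: "(real ^ 'n \<Rightarrow> ennreal) \<Rightarrow> bool" where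
  "mixed_weak_estimate v \<longleftrightarrow>
     (\<exists>c::real. \<forall>f. integrable lborel f \<longrightarrow>
        weak_L1_norm v (\<lambda>x. maximal_fun f x / v x) \<le> ennreal c * L1_norm f)"

definition weight_function :: "(real ^ 'n \<Rightarrow> real) \<Rightarrow> bool" where
  "weight_function w \<longleftrightarrow> w \<in> borel_measurable borel \<and> (\<forall>x. 0 \<le> w x) \<and>
     (\<forall>K. compact K \<longrightarrow> set_integrable lborel K w)"

definition weight_measure :: "(real ^ 'n) measure \<Rightarrow> bool" where
  "weight_measure \<mu> \<longleftrightarrow> sets \<mu> = sets borel \<and> (\<forall>K. compact K \<longrightarrow> emeasure \<mu> K < \<infinity>)"

end

(* Take f = w, the indicator of a cube. Then M f / M w = 1 everywhere, so the superlevel set at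
   height 1/2 is the whole space, while M w decays like |x|^(-n) and is therefore not integrable. *)
theory Submission imports Defs begin

text \<open>If \<open>f = w\<close>, then M f / M w equals 1 wherever 0 < M w < infinity. When this
  holds everywhere, each level t with 0 < t < 1 has the whole space as its superlevel set, and the
  weak norm with weight M w is at least t times the integral of M w. For \<open>w\<close> the
  indicator of a cube that integral diverges: averaging over a larger cube containing both x and the
  support shows that M w decays no faster than |x|^(-n), which is not integrable at infinity. Since
  \<open>w\<close> has finite L1 norm, no constant can work.
  \<open>not_mixed_weak_estimate_maximal_fun\<close> isolates this argument,
  \<open>nn_integral_maximal_fun_dyadic_cube\<close> supplies the divergence, and
  \<open>maximal_measure_density\<close> carries the counterexample over to measures.\<close>

lemma emeasure_lborel_cube:
  fixes a :: "real ^ 'n"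
  assumes "0 \<le> l"
  shows "emeasure lborel (cbox a (\<chi> i. a $ i + l)) = ennreal (l ^ CARD('n))"
proof -
  have ne: "cbox a (\<chi> i. a $ i + l) \<noteq> {}"
    using assms by (simp add: interval_eq_empty_cart not_less)
  have "emeasure lborel (cbox a (\<chi> i. a $ i + l)) =
      ennreal (measure lborel (cbox a (\<chi> i. a $ i + l)))"
    using emeasure_lborel_cbox_finite[of a "\<chi> i. a $ i + l"]
    by (intro emeasure_eq_ennreal_measure) auto
  also have "measure lborel (cbox a (\<chi> i. a $ i + l)) = l ^ CARD('n)"
    using content_cbox_cart[OF ne] by simp
  finally show ?thesis .
qed

lemma cubesE:
  fixes Q :: "(real ^ 'n) set"
  assumes "Q \<in> cubes"
  obtains r where "0 < r" "emeasure lborel Q = ennreal r" "Q \<in> sets borel"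
proof -
  obtain a l where Q: "Q = cbox a (\<chi> i. a $ i + l)" "0 < l"
    using assms by (auto simp: cubes_def)
  show ?thesis
    using Q by (intro that[of "l ^ CARD('n)"]) (simp_all add: emeasure_lborel_cube)
qed

lemma maximal_fun_ge:
  assumes "Q \<in> cubes" "x \<in> Q"
  shows "(\<integral>\<^sup>+y\<in>Q. ennreal \<bar>h y\<bar> \<partial>lborel) / emeasure lborel Q \<le> maximal_fun h x"
  unfolding maximal_fun_def using assms by (intro SUP_upper) auto

text \<open>Averages of a function bounded by 1 are bounded by 1. This supplies the finiteness of M
  w.\<close>

lemma maximal_fun_indicator_le_1:
  fixes A :: "(real ^ 'n) set"
  shows "maximal_fun (indicator A) x \<le> 1"
  unfolding maximal_fun_def
proof (rule SUP_least, safe)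
  fix Q :: "(real ^ 'n) set"
  assume "Q \<in> cubes"
  then obtain r where r: "0 < r" "emeasure lborel Q = ennreal r" "Q \<in> sets borel"
    by (rule cubesE)
  have "(\<integral>\<^sup>+y\<in>Q. ennreal \<bar>indicator A y\<bar> \<partial>lborel) \<le> (\<integral>\<^sup>+y. indicator Q y \<partial>lborel)"
    by (intro nn_integral_mono) (auto simp: indicator_def)
  also have "\<dots> = ennreal r"
    using r by simp
  finally show "(\<integral>\<^sup>+y\<in>Q. ennreal \<bar>indicator A y\<bar> \<partial>lborel) / emeasure lborel Q \<le> 1"
    using r by (simp add: divide_le_posI_ennreal)
qed

text \<open>The measure with density \<open>w\<close> gives each cube the mass that \<open>w\<close>
  integrates to there, so one counterexample refutes both forms of the estimate.\<close>

lemma maximal_measure_density: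
  assumes "w \<in> borel_measurable borel" "\<And>x. 0 \<le> w x"
  shows "maximal_measure (density lborel (\<lambda>x. ennreal (w x))) = maximal_fun w"
proof
  fix x :: "real ^ 'a"
  have "emeasure (density lborel (\<lambda>x. ennreal (w x))) Q = (\<integral>\<^sup>+y\<in>Q. ennreal \<bar>w y\<bar> \<partial>lborel)"
    if "Q \<in> cubes" for Q
    using that assms by (auto elim!: cubesE simp: emeasure_density)
  then show "maximal_measure (density lborel (\<lambda>x. ennreal (w x))) x = maximal_fun w x"
    unfolding maximal_measure_def maximal_fun_def by (intro SUP_cong) auto
qed

text \<open>Testing with \<open>f = w\<close> makes the left side infinite and leaves the right side
  finite. Positivity and finiteness of M w make the quotient 1, because in \<open>ennreal\<close>
  both 0/0 and infinity/infinity are 0.\<close>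

lemma not_mixed_weak_estimate_maximal_fun:
  assumes w: "integrable lborel w"
    and pos: "\<And>x. 0 < maximal_fun w x" and fin: "\<And>x. maximal_fun w x < \<infinity>"
    and inf: "(\<integral>\<^sup>+x. maximal_fun w x \<partial>lborel) = \<infinity>"
  shows "\<not> mixed_weak_estimate (maximal_fun w)"
proof
  assume "mixed_weak_estimate (maximal_fun w)"
  then obtain c where c:
    "weak_L1_norm (maximal_fun w) (\<lambda>x. maximal_fun w x / maximal_fun w x) \<le> ennreal c * L1_norm w"
    using w by (auto simp: mixed_weak_estimate_def)
  have one: "maximal_fun w x / maximal_fun w x = 1" for x
    using pos[of x] fin[of x] by (intro ennreal_divide_self) auto
  \<comment> \<open>Any level strictly between 0 and 1 would serve.\<close>
  have half: "ennreal (1/2) < 1"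
    using ennreal_lessI[of 1 "1/2"] by simp
  have "ennreal (1/2) *
      (\<integral>\<^sup>+x\<in>{x. maximal_fun w x / maximal_fun w x > ennreal (1/2)}. maximal_fun w x \<partial>lborel)
      \<le> weak_L1_norm (maximal_fun w) (\<lambda>x. maximal_fun w x / maximal_fun w x)"
    unfolding weak_L1_norm_def by (rule SUP_upper) simp
  then have "weak_L1_norm (maximal_fun w) (\<lambda>x. maximal_fun w x / maximal_fun w x) = \<infinity>"
    using inf half by (simp add: one ennreal_mult_top top_unique)
  moreover have "L1_norm w < \<infinity>"
    using w by (simp add: L1_norm_def integrable_iff_bounded)
  ultimately show False
    using c by (simp add: top_unique ennreal_mult_eq_top_iff)
qed

text \<open>These are concentric cubes centred at the origin, of side \<open>2 ^ Suc k\<close>, not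
  cells of the dyadic grid. They increase with \<open>k\<close> and exhaust the space.\<close>

definition dyadic_cube :: "nat \<Rightarrow> (real ^ 'n) set" where
  "dyadic_cube k = cbox (\<chi> i. - (2 ^ k)) (\<chi> i. 2 ^ k)"

lemma dyadic_cube_eq:
  "dyadic_cube k = (cbox (\<chi> i. - (2 ^ k)) (\<chi> i. (\<chi> i. - (2 ^ k)) $ i + 2 ^ Suc k) :: (real ^ 'n) set)"
  by (simp add: dyadic_cube_def)

lemma dyadic_cube_in_cubes: "dyadic_cube k \<in> cubes"
  unfolding cubes_def dyadic_cube_eq
  by (intro CollectI exI conjI) (rule refl, simp)

lemma sets_dyadic_cube [measurable]: "dyadic_cube k \<in> sets borel"
  by (simp add: dyadic_cube_def)

lemma emeasure_dyadic_cube: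
  "emeasure lborel (dyadic_cube k :: (real ^ 'n) set) = ennreal ((2 ^ Suc k) ^ CARD('n))"
  unfolding dyadic_cube_eq by (rule emeasure_lborel_cube) simp

lemma dyadic_cube_mono:
  assumes "j \<le> k"
  shows "dyadic_cube j \<subseteq> dyadic_cube k"
proof -
  have "(2::real) ^ j \<le> 2 ^ k"
    using assms by simp
  then have "- (2 ^ k) \<le> y \<and> y \<le> 2 ^ k" if "- (2 ^ j) \<le> y \<and> y \<le> 2 ^ j" for y :: real
    using that by linarith
  then show ?thesis
    unfolding dyadic_cube_def subset_iff mem_box_cart vec_lambda_beta by blast
qed

lemma ex_dyadic_cube:
  fixes x :: "real ^ 'n"
  shows "\<exists>k. x \<in> dyadic_cube k"
proof -
  obtain k where k: "norm x < 2 ^ k"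
    using real_arch_pow[of 2 "norm x"] by auto
  have "\<bar>x $ i\<bar> \<le> 2 ^ k" for i
    using component_le_norm_cart[of x i] k by linarith
  then have "x \<in> dyadic_cube k"
    by (auto simp: dyadic_cube_def mem_box_cart abs_le_iff minus_le_iff)
  then show ?thesis ..
qed

text \<open>Since \<open>dyadic_cube k\<close> contains \<open>dyadic_cube 0\<close>, the average of
  the indicator over it is the ratio of the two volumes.\<close>

lemma maximal_fun_dyadic_cube_ge:
  fixes x :: "real ^ 'n"
  assumes "x \<in> dyadic_cube k"
  shows "ennreal (1 / (2 ^ k) ^ CARD('n)) \<le> maximal_fun (indicator (dyadic_cube 0)) x"
proof -
  have "(\<integral>\<^sup>+y\<in>dyadic_cube k. ennreal \<bar>indicator (dyadic_cube 0 :: (real ^ 'n) set) y\<bar> \<partial>lborel) =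
      (\<integral>\<^sup>+y. indicator (dyadic_cube 0 :: (real ^ 'n) set) y \<partial>lborel)"
    using dyadic_cube_mono[of 0 k]
    by (intro nn_integral_cong) (auto simp: indicator_def)
  also have "\<dots> = ennreal (2 ^ CARD('n))"
    by (simp add: emeasure_dyadic_cube)
  finally have "(\<integral>\<^sup>+y\<in>dyadic_cube k. ennreal \<bar>indicator (dyadic_cube 0 :: (real ^ 'n) set) y\<bar> \<partial>lborel)
      / emeasure lborel (dyadic_cube k :: (real ^ 'n) set) = ennreal (1 / (2 ^ k) ^ CARD('n))"
    by (simp add: emeasure_dyadic_cube divide_ennreal power_mult_distrib)
  then show ?thesis
    using maximal_fun_ge[OF dyadic_cube_in_cubes assms, of "indicator (dyadic_cube 0)"] by simp
qed

text \<open>A measurable minorant is used because measurability of the maximal function is not available: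
  each dyadic shell contributes \<open>2\<^sup>n - 1 \<ge> 1\<close> to its integral.\<close>

lemma nn_integral_maximal_fun_dyadic_cube:
  "(\<integral>\<^sup>+x. maximal_fun (indicator (dyadic_cube 0 :: (real ^ 'n) set)) x \<partial>lborel) = \<infinity>"
proof -
  let ?n = "CARD('n)"
  define S where "S k = (dyadic_cube (Suc k) - dyadic_cube k :: (real ^ 'n) set)" for k
  \<comment> \<open>This bounds M w from below on \<open>S k\<close>; the exponent is
    \<open>Suc k\<close> because the shell lies in \<open>dyadic_cube (Suc k)\<close> but outside
    \<open>dyadic_cube k\<close>.\<close>
  define a where "a k = ennreal (1 / (2 ^ Suc k) ^ ?n)" for k
  have S [measurable]: "S k \<in> sets borel" for k
    by (simp add: S_def)
  have shell: "1 \<le> (\<integral>\<^sup>+x. a k * indicator (S k) x \<partial>lborel)" for k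
  proof -
    have "emeasure lborel (S k) = ennreal ((2 ^ Suc (Suc k)) ^ ?n) - ennreal ((2 ^ Suc k) ^ ?n)"
      unfolding S_def using dyadic_cube_mono[of k "Suc k"]
      by (subst emeasure_Diff) (auto simp: emeasure_dyadic_cube)
    also have "\<dots> = ennreal ((2 ^ Suc (Suc k)) ^ ?n - (2 ^ Suc k) ^ ?n)"
      by (rule ennreal_minus) simp
    finally have S_eq: "emeasure lborel (S k) = ennreal ((2 ^ Suc (Suc k)) ^ ?n - (2 ^ Suc k) ^ ?n)" .
    \<comment> \<open>The dimension is at least 1, so the scale-invariant contribution
      \<open>2 ^ ?n - 1\<close> of a shell is at least 1.\<close>
    have "(2::real) ^ 1 \<le> 2 ^ ?n"
      by (rule power_increasing) (auto simp: Suc_leI)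
    then have "1 \<le> (2::real) ^ ?n - 1"
      by simp
    also have "\<dots> = 1 / (2 ^ Suc k) ^ ?n * ((2 ^ Suc (Suc k)) ^ ?n - (2 ^ Suc k) ^ ?n)"
      by (simp add: power_Suc[of 2 "Suc k"] power_mult_distrib[of 2 "2 ^ Suc k"] field_simps
          del: power_Suc)
    finally show ?thesis
      by (simp only: nn_integral_cmult_indicator S_eq S sets_lborel a_def
          ennreal_mult'[symmetric] ennreal_1[symmetric])
        (simp add: ennreal_mult'[symmetric] ennreal_leI del: ennreal_1 power_Suc)
  qed
  have minorant: "(\<Sum>k<m. a k * indicator (S k) x) \<le> maximal_fun (indicator (dyadic_cube 0)) x"
    for m and x :: "real ^ 'n"
  proof (cases "\<exists>j<m. x \<in> S j")
    case True
    then obtain j where j: "j < m" "x \<in> S j"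
      by blast
    \<comment> \<open>Nesting makes the shells disjoint: the outer cube of the earlier shell lies in
      the cube removed from the later one. Hence at most one term of the sum survives.\<close>
    have "x \<notin> S k" if "k \<noteq> j" for k
      using that j dyadic_cube_mono[of "Suc k" j] dyadic_cube_mono[of "Suc j" k]
      by (cases "k < j") (auto simp: S_def)
    then have "(\<Sum>k<m. a k * indicator (S k) x) = (\<Sum>k<m. if k = j then a j else 0)"
      using j by (intro sum.cong) auto
    also have "\<dots> = a j"
      using j by simp
    also have "\<dots> \<le> maximal_fun (indicator (dyadic_cube 0)) x"
      unfolding a_def by (rule maximal_fun_dyadic_cube_ge) (use j in \<open>auto simp: S_def\<close>)
    finally show ?thesis .
  qed (auto simp: sum.neutral)
  have "of_nat m \<le> (\<integral>\<^sup>+x. maximal_fun (indicator (dyadic_cube 0 :: (real ^ 'n) set)) x \<partial>lborel)" for m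
  proof -
    have "of_nat m = (\<Sum>k<m. 1 :: ennreal)"
      by simp
    also have "\<dots> \<le> (\<Sum>k<m. \<integral>\<^sup>+x. a k * indicator (S k) x \<partial>lborel)"
      by (intro sum_mono shell)
    also have "\<dots> = (\<integral>\<^sup>+x. (\<Sum>k<m. a k * indicator (S k) x) \<partial>lborel)"
      by (rule nn_integral_sum[symmetric]) simp
    also have "\<dots> \<le> (\<integral>\<^sup>+x. maximal_fun (indicator (dyadic_cube 0 :: (real ^ 'n) set)) x \<partial>lborel)"
      by (intro nn_integral_mono minorant)
    finally show ?thesis .
  qed
  then show ?thesis
    by (metis ennreal_Ex_less_of_nat infinity_ennreal_def leD top.not_eq_extremum)
qed

theorem mainTheorem8:
  "\<not> (\<forall>w :: real ^ 'n \<Rightarrow> real. weight_function w \<longrightarrow> mixed_weak_estimate (maximal_fun w)) \<and>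
   \<not> (\<forall>\<mu> :: (real ^ 'n) measure. weight_measure \<mu> \<longrightarrow> mixed_weak_estimate (maximal_measure \<mu>))"
proof -
  define w :: "real ^ 'n \<Rightarrow> real" where "w = indicator (dyadic_cube 0)"
  define \<mu> where "\<mu> = density lborel (\<lambda>x. ennreal (w x))"
  have w_meas [measurable]: "w \<in> borel_measurable borel"
    by (simp add: w_def)
  have w_nonneg: "0 \<le> w x" for x
    by (simp add: w_def)
  have w_int: "integrable lborel w"
    by (simp add: w_def emeasure_dyadic_cube)
  \<comment> \<open>Every point lies in some \<open>dyadic_cube k\<close>, whose average is already
    positive.\<close>
  have pos: "0 < maximal_fun w x" for x
  proof -
    obtain k where "x \<in> dyadic_cube k"
      using ex_dyadic_cube by blast
    from maximal_fun_dyadic_cube_ge[OF this] show ?thesis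
      unfolding w_def by (rule less_le_trans[rotated]) simp
  qed
  have fin: "maximal_fun w x < \<infinity>" for x
    using maximal_fun_indicator_le_1[of "dyadic_cube 0" x] unfolding w_def
    by (rule le_less_trans) simp
  have bad: "\<not> mixed_weak_estimate (maximal_fun w)"
    using w_int pos fin nn_integral_maximal_fun_dyadic_cube
    by (intro not_mixed_weak_estimate_maximal_fun) (auto simp: w_def)
  have "weight_function w"
    unfolding weight_function_def set_integrable_def
    by (intro conjI allI impI w_meas w_nonneg integrable_mult_indicator w_int)
      (simp add: borel_closed compact_imp_closed)
  moreover have "weight_measure \<mu>"
    unfolding weight_measure_def
  proof (intro conjI allI impI)
    fix K :: "(real ^ 'n) set"
    assume "compact K"
    then have "emeasure \<mu> K = (\<integral>\<^sup>+x\<in>K. ennreal (w x) \<partial>lborel)"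
      by (simp add: \<mu>_def emeasure_density borel_closed compact_imp_closed)
    also have "\<dots> \<le> (\<integral>\<^sup>+x. ennreal (norm (w x)) \<partial>lborel)"
      by (intro nn_integral_mono) (auto simp: indicator_def w_nonneg)
    also have "\<dots> < \<infinity>"
      using w_int by (simp add: integrable_iff_bounded)
    finally show "emeasure \<mu> K < \<infinity>" .
  qed (simp add: \<mu>_def)
  moreover have "maximal_measure \<mu> = maximal_fun w"
    unfolding \<mu>_def by (rule maximal_measure_density[OF w_meas w_nonneg])
  ultimately show ?thesis
    using bad by metis
qed

end
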